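(* Assume CH. Then there exists a tight MAD family $\{a_\alpha:\alpha<\omega_1\}$ on $\omega$ such that for every club $K\subseteq\omega_1$ the family $\{a_\alpha:\alpha\in K\}$ is not fin-intersecting, and there exists a stationary set $S\subseteq\omega_1$ such that $\{a_\alpha:\alpha\in S\}$ is fin-intersecting.
   Context: An almost disjoint family (on $\omega$) is an infinite set $\mathcal A$ of infinite subsets of $\omega$ such that $a\cap b$ is finite for all distinct $a,b\in\mathcal A$. A MAD family is an almost disjoint family not properly contained in any other almost disjoint family. In an indexed almost disjoint family $\{a_\alpha:\alpha<\omega_1\}$ the sets $a_\alpha$ are pairwise distinct (so $a_\alpha\cap a_\beta$ is finite for $\alpha\ne\beta$). $\mathcal I(\mathcal A)$ is the ideal $\{X\subseteq\omega:\exists\mathcal B\in[\mathcal A]^{<\omega}\ X\subseteq^*\bigcup\mathcal B\}$, where $\subseteq^*$ is inclusion modulo a finite set, and $\mathcal I^+(\mathcal A)=\mathcal P(\omega)\setminus\mathcal I(\mathcal A)$. A tight MAD family (also called $\aleph_0$-MAD) is an almost disjoint family $\mathcal A$ such that for every sequence $(X_n:n\in\omega)$ of elements of $\mathcal I^+(\mathcal A)$ there exists $a\in\mathcal A$ such that $a\cap X_n$ is infinite for every $n\in\omega$. A family $\mathcal F\subseteq\mathcal P(\omega)$ is centered if $\bigcap\mathcal B$ is infinite for every finite nonempty $\mathcal B\subseteq\mathcal F$. A fin sequence is a function $C:\omega\to[\omega]^{<\omega}\setminus\{\emptyset\}$ such that $C(n)\cap C(m)=\emptyset$ whenever $n\neq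 m$. An almost disjoint family $\mathcal A$ is fin-intersecting if for every fin sequence $C$ there exists an infinite $I\subseteq\omega$ such that $\{\{n\in I:a\cap C(n)\neq\emptyset\}:a\in\mathcal A\}\setminus[I]^{<\omega}$ is centered. "Club" means closed unbounded subset of $\omega_1$. *)

theory Defs
  imports Main
begin

(* omega_1 as a (reflexive) well-order relation: natLeq is aleph_0 and cardSuc is the
   cardinal successor, so the order type is that of the least uncountable ordinal.
   The countable ordinals are the elements of Field omega1; which sets of naturals the
   library picks to represent them is irrelevant. *)
definition omega1 :: "nat set rel" where
  "omega1 = cardSuc natLeq"

definition CH :: bool where
  "CH \<longleftrightarrow> (card_of (UNIV :: nat set set), omega1) \<in> ordIso"

(* underS omega1 d is the set of ordinals strictly below d. In the closure clause, d is
   nonzero and a limit of members of K below d; this forces d to be a limit ordinal. *)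
definition club :: "nat set set \<Rightarrow> bool" where
  "club K \<longleftrightarrow> K \<subseteq> Field omega1 \<and>
     (\<forall>\<alpha>\<in>Field omega1. \<exists>\<beta>\<in>K. \<alpha> \<in> underS omega1 \<beta>) \<and>
     (\<forall>\<delta>\<in>Field omega1.
        underS omega1 \<delta> \<noteq> {} \<and>
        (\<forall>\<alpha>\<in>underS omega1 \<delta>. \<exists>\<beta>\<in>K \<inter> underS omega1 \<delta>. \<alpha> \<in> underS omega1 \<beta>)
        \<longrightarrow> \<delta> \<in> K)"

definition stationary :: "nat set set \<Rightarrow> bool" where
  "stationary S \<longleftrightarrow> S \<subseteq> Field omega1 \<and> (\<forall>K. club K \<longrightarrow> S \<inter> K \<noteq> {})"

definition almost_disjoint :: "nat set set \<Rightarrow> bool" where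
  "almost_disjoint \<A> \<longleftrightarrow> infinite \<A> \<and> (\<forall>a\<in>\<A>. infinite a) \<and>
     (\<forall>a\<in>\<A>. \<forall>b\<in>\<A>. a \<noteq> b \<longrightarrow> finite (a \<inter> b))"

definition almost_subset :: "nat set \<Rightarrow> nat set \<Rightarrow> bool" where
  "almost_subset X Y \<longleftrightarrow> finite (X - Y)"

definition ad_ideal :: "nat set set \<Rightarrow> nat set set" where
  "ad_ideal \<A> = {X. \<exists>\<B>. finite \<B> \<and> \<B> \<subseteq> \<A> \<and> almost_subset X (\<Union>\<B>)}"

definition ad_positive :: "nat set set \<Rightarrow> nat set set" where
  "ad_positive \<A> = UNIV - ad_ideal \<A>"

definition tight_MAD :: "nat set set \<Rightarrow> bool" where
  "tight_MAD \<A> \<longleftrightarrow> almost_disjoint \<A> \<and>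
     (\<forall>X :: nat \<Rightarrow> nat set. (\<forall>n. X n \<in> ad_positive \<A>) \<longrightarrow>
        (\<exists>a\<in>\<A>. \<forall>n. infinite (a \<inter> X n)))"

definition centered :: "nat set set \<Rightarrow> bool" where
  "centered \<F> \<longleftrightarrow> (\<forall>\<B>. finite \<B> \<and> \<B> \<noteq> {} \<and> \<B> \<subseteq> \<F> \<longrightarrow> infinite (\<Inter>\<B>))"

definition fin_sequence :: "(nat \<Rightarrow> nat set) \<Rightarrow> bool" where
  "fin_sequence C \<longleftrightarrow> (\<forall>n. finite (C n) \<and> C n \<noteq> {}) \<and>
     (\<forall>n m. n \<noteq> m \<longrightarrow> C n \<inter> C m = {})"

(* Meant for almost disjoint families only; almost disjointness is not part of the
   predicate, so its negation cannot hold merely because that precondition fails. *)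
definition fin_intersecting :: "nat set set \<Rightarrow> bool" where
  "fin_intersecting \<A> \<longleftrightarrow> (\<forall>C. fin_sequence C \<longrightarrow>
     (\<exists>I. infinite I \<and>
        centered ((\<lambda>a. {n \<in> I. a \<inter> C n \<noteq> {}}) ` \<A> - {J. J \<subseteq> I \<and> finite J})))"

end

theory Submission
  imports Defs "HOL-Library.Countable_Set_Type"
begin

text \<open>
  Fix a partition of the naturals into finite blocks of growing size. Under CH, every real
  can be assigned to stationarily many countable ordinals, and these reals act as tasks for a
  recursive choice of sets \<open>A x\<close>, each meeting every block at most once. Fin sequences are
  enumerated as \<open>C x\<close>; at stage \<open>x\<close> one also picks an infinite \<open>I x\<close> which
  is almost contained in or almost disjoint from the trace \<open>{n. A y \<inter> C x n \<noteq> {}}\<close> for every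
  \<open>y \<le> x\<close>, while the sets \<open>A x\<close> and \<open>U x = (\<Union>n\<in>I x. C x n)\<close> keep generating a proper
  ideal.

  On one stationary set, \<open>A x\<close> is almost disjoint from all earlier \<open>U y\<close>. Hence on \<open>I y\<close> every
  trace of a member with index in that set is finite or cofinite, and the infinite ones are
  centered.

  For each infinite \<open>D\<close>, there is another stationary set on which \<open>A x\<close> only meets blocks with
  index in \<open>D\<close>. For a club \<open>K\<close> the blocks then witness that the subfamily is not
  fin-intersecting: given \<open>I\<close>, split it into infinite \<open>J1\<close> and \<open>J2\<close>, and find members with
  index in \<open>K\<close> whose infinite traces lie inside \<open>J1\<close> and inside \<open>J2\<close>.

  Tightness is ensured at the remaining ordinals.
\<close>

section \<open>Countable ordinals and stationary sets\<close>

unbundle cardinal_syntax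

section \<open>The countable ordinals as a well-ordered type\<close>

lemma Card_order_omega1: "Card_order omega1"
  unfolding omega1_def by (simp add: cardSuc_Card_order natLeq_Card_order)

lemma Well_order_omega1: "Well_order omega1"
  using Card_order_omega1 by (rule card_order_on_well_order_on)

lemma Field_omega1_nonempty: "Field omega1 \<noteq> {}"
  unfolding omega1_def
  by (metis Field_natLeq UNIV_not_empty natLeq_Card_order Field_cardSuc_not_empty)

text \<open>A type of its own makes the class \<open>wellorder\<close> available, with intervals,
  \<open>LEAST\<close> and recursion along \<open><\<close>.\<close>

typedef countable_ordinal = "Field omega1"
  using Field_omega1_nonempty by blast

instantiation countable_ordinal :: wellorder
begin

definition less_eq_countable_ordinal :: "countable_ordinal \<Rightarrow> countable_ordinal \<Rightarrow> bool" where
  "x \<le> y \<longleftrightarrow> (Rep_countable_ordinal x, Rep_countable_ordinal y) \<in> omega1"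

definition less_countable_ordinal :: "countable_ordinal \<Rightarrow> countable_ordinal \<Rightarrow> bool" where
  "x < y \<longleftrightarrow> Rep_countable_ordinal x \<in> underS omega1 (Rep_countable_ordinal y)"

instance
proof
  have wo: "refl_on (Field omega1) omega1" "trans omega1" "antisym omega1"
      "total_on (Field omega1) omega1" "wf (omega1 - Id)"
    using Well_order_omega1
    by (auto simp: well_order_on_def linear_order_on_def partial_order_on_def preorder_on_def)
  have total: "(a, b) \<in> omega1 \<or> (b, a) \<in> omega1" if "a \<in> Field omega1" "b \<in> Field omega1" for a b
    using wo(1,4) that by (cases "a = b") (auto simp: refl_on_def total_on_def)
  fix x y z :: countable_ordinal
  note R = Rep_countable_ordinal[of x] Rep_countable_ordinal[of y]
  show "x \<le> x"
    using wo(1) R by (auto simp: less_eq_countable_ordinal_def refl_on_def)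
  show "x \<le> z" if "x \<le> y" "y \<le> z"
    using wo(2) that unfolding less_eq_countable_ordinal_def by (rule transD)
  show eq: "x = y" if "x \<le> y" "y \<le> x"
    using wo(3) that unfolding less_eq_countable_ordinal_def
    by (metis Rep_countable_ordinal_inject antisymD)
  show "x \<le> y \<or> y \<le> x"
    using total R unfolding less_eq_countable_ordinal_def by blast
  show "x < y \<longleftrightarrow> x \<le> y \<and> \<not> y \<le> x"
    using wo(3) total R unfolding less_eq_countable_ordinal_def less_countable_ordinal_def underS_def
    by (auto dest: antisymD)
next
  fix P :: "countable_ordinal \<Rightarrow> bool" and a
  assume step: "\<And>x. (\<And>y. y < x \<Longrightarrow> P y) \<Longrightarrow> P x"
  have "wf (omega1 - Id)"
    using Well_order_omega1 by (auto simp: well_order_on_def)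
  then have wf: "wf (inv_image (omega1 - Id) Rep_countable_ordinal)"
    by (rule wf_inv_image)
  show "P a"
  proof (induction a rule: wf_induct_rule[OF wf])
    case (1 x)
    show ?case
      by (rule step, rule 1) (auto simp: less_countable_ordinal_def underS_def)
  qed
qed

end

lemma range_Rep_countable_ordinal: "range Rep_countable_ordinal = Field omega1"
  using type_definition.Rep_range[OF type_definition_countable_ordinal] .

lemma countable_lessThan: "countable {..<x :: countable_ordinal}"
proof -
  let ?r = "Rep_countable_ordinal"
  have "|underS omega1 (?r x)| <o omega1"
    using Card_order_omega1 Rep_countable_ordinal by (rule card_of_underS)
  then have "|underS omega1 (?r x)| \<le>o natLeq"
    unfolding omega1_def
    by (simp add: cardSuc_ordLeq_ordLess[OF natLeq_Card_order card_of_Card_order])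
  then have "countable (underS omega1 (?r x))"
    by (simp add: countable_card_le_natLeq)
  then have "countable (?r ` {..<x})"
    by (rule countable_subset[rotated]) (auto simp: less_countable_ordinal_def)
  then show ?thesis
    by (rule countable_image_inj_on) (auto simp: inj_on_def Rep_countable_ordinal_inject)
qed

lemma uncountable_countable_ordinal: "uncountable (UNIV :: countable_ordinal set)"
proof
  assume "countable (UNIV :: countable_ordinal set)"
  then have "countable (Field omega1)"
    unfolding range_Rep_countable_ordinal[symmetric] by (rule countable_image)
  then have "|Field omega1| \<le>o natLeq"
    by (simp add: countable_card_le_natLeq)
  moreover have "|Field omega1| =o omega1"
    using Card_order_omega1 by (rule card_of_Field_ordIso)
  moreover have "natLeq <o omega1"
    unfolding omega1_def using natLeq_Card_order by (rule cardSuc_greater)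
  ultimately show False
    using not_ordLess_ordLeq ordIso_ordLeq_trans ordIso_symmetric by blast
qed

text \<open>Otherwise countably many initial segments, each countable, would cover the uncountable
  type.\<close>

lemma countable_imp_strictly_bounded:
  assumes "countable (A :: countable_ordinal set)"
  shows "\<exists>b. \<forall>x\<in>A. x < b"
proof (rule ccontr)
  assume "\<not> ?thesis"
  then have "UNIV \<subseteq> (\<Union>x\<in>A. {..<x} \<union> {x})"
    by (force simp: not_less le_less)
  moreover have "countable (\<Union>x\<in>A. {..<x} \<union> {x})"
    using assms countable_lessThan by auto
  ultimately show False
    using uncountable_countable_ordinal countable_subset by blast
qed

text \<open>An uncountable set has at least the cardinality of \<open>omega1\<close>, which under
  \<open>CH\<close> is that of the reals. No other proof unfolds \<open>CH\<close>.\<close>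

lemma inj_reals_into_uncountable:
  assumes CH and "uncountable (E :: countable_ordinal set)"
  shows "\<exists>h :: nat set \<Rightarrow> countable_ordinal. inj h \<and> range h \<subseteq> E"
proof -
  have "\<not> |E| \<le>o natLeq"
    using assms(2) by (simp add: countable_card_le_natLeq)
  then have "natLeq <o |E|"
    using not_ordLeq_iff_ordLess card_of_Well_order natLeq_Well_order by blast
  then have "omega1 \<le>o |E|"
    unfolding omega1_def by (intro cardSuc_least natLeq_Card_order card_of_Card_order)
  then have "|UNIV :: nat set set| \<le>o |E|"
    using assms(1) ordIso_ordLeq_trans unfolding CH_def by blast
  then show ?thesis
    unfolding card_of_ordLeq[symmetric] by blast
qed

section \<open>Clubs, stationary sets and their transfer\<close>

definition club_set :: "countable_ordinal set \<Rightarrow> bool" where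
  "club_set K \<longleftrightarrow> (\<forall>x. \<exists>y\<in>K. x < y) \<and>
     (\<forall>d. (\<exists>x. x < d) \<and> (\<forall>x<d. \<exists>y\<in>K. x < y \<and> y < d) \<longrightarrow> d \<in> K)"

definition stationary_set :: "countable_ordinal set \<Rightarrow> bool" where
  "stationary_set S \<longleftrightarrow> (\<forall>K. club_set K \<longrightarrow> S \<inter> K \<noteq> {})"

lemma club_imp_club_set:
  assumes "club K"
  shows "club_set (Rep_countable_ordinal -` K)"
proof -
  let ?r = "Rep_countable_ordinal"
  have K: "K \<subseteq> Field omega1"
    and unb: "\<And>x. x \<in> Field omega1 \<Longrightarrow> \<exists>y\<in>K. x \<in> underS omega1 y"
    and cl: "\<And>d. d \<in> Field omega1 \<Longrightarrow> underS omega1 d \<noteq> {} \<Longrightarrow>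
      (\<forall>x\<in>underS omega1 d. \<exists>y\<in>K \<inter> underS omega1 d. x \<in> underS omega1 y) \<Longrightarrow> d \<in> K"
    using assms unfolding club_def by blast+
  have rep: "\<exists>x'. y = ?r x'" if "y \<in> Field omega1" for y
    using that range_Rep_countable_ordinal by auto
  have US: "underS omega1 d \<subseteq> Field omega1" for d
    by (auto simp: underS_def Field_def)
  show ?thesis
    unfolding club_set_def
  proof (intro conjI allI impI)
    fix x
    obtain y where "y \<in> K" "?r x \<in> underS omega1 y"
      using unb Rep_countable_ordinal by blast
    then show "\<exists>y\<in>?r -` K. x < y"
      using K rep[of y] by (auto simp: less_countable_ordinal_def)
  next
    fix d assume d: "(\<exists>x. x < d) \<and> (\<forall>x<d. \<exists>y\<in>?r -` K. x < y \<and> y < d)"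
    have "?r d \<in> K"
    proof (rule cl[OF Rep_countable_ordinal])
      show "underS omega1 (?r d) \<noteq> {}"
        using d by (auto simp: less_countable_ordinal_def)
      show "\<forall>x\<in>underS omega1 (?r d). \<exists>y\<in>K \<inter> underS omega1 (?r d). x \<in> underS omega1 y"
      proof
        fix x assume x: "x \<in> underS omega1 (?r d)"
        then obtain x' where "x = ?r x'"
          using US rep by blast
        then show "\<exists>y\<in>K \<inter> underS omega1 (?r d). x \<in> underS omega1 y"
          using d x by (auto simp: less_countable_ordinal_def)
      qed
    qed
    then show "d \<in> ?r -` K" by simp
  qed
qed

lemma stationary_Rep_image:
  assumes "stationary_set S"
  shows "stationary (Rep_countable_ordinal ` S)"
  unfolding stationary_def
proof (intro conjI allI impI)
  show "Rep_countable_ordinal ` S \<subseteq> Field omega1"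
    using Rep_countable_ordinal by blast
  fix K assume "club K"
  then have "S \<inter> Rep_countable_ordinal -` K \<noteq> {}"
    using assms club_imp_club_set unfolding stationary_set_def by blast
  then show "Rep_countable_ordinal ` S \<inter> K \<noteq> {}"
    by blast
qed

text \<open>Climb an increasing sequence above \<open>x\<close> that returns to each
  \<open>K n\<close> infinitely often; its supremum is a limit of every \<open>K n\<close>.\<close>

lemma countable_club_Inter_unbounded:
  fixes K :: "nat \<Rightarrow> countable_ordinal set"
  assumes "\<And>n. club_set (K n)"
  shows "\<exists>d>x. \<forall>n. d \<in> K n"
proof -
  have "\<exists>y\<in>K n. x < y" for n x
    using assms unfolding club_set_def by blast
  then obtain s where s: "\<And>n x. s n x \<in> K n" "\<And>n x. x < s n x"
    by metis
  \<comment> \<open>\<open>fst (prod_decode m)\<close> takes each value \<open>n\<close> at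
    arbitrarily large \<open>m\<close>, so no club is left behind.\<close>
  define h where "h = rec_nat x (\<lambda>m y. s (fst (prod_decode m)) y)"
  have h_Suc: "h (Suc m) = s (fst (prod_decode m)) (h m)" for m
    by (simp add: h_def)
  have h0: "h 0 = x"
    by (simp add: h_def)
  have mono: "strict_mono h"
    by (simp add: strict_mono_Suc_iff h_Suc s)
  \<comment> \<open>As the sequence increases strictly, its least strict upper bound is its
    supremum.\<close>
  define d where "d = (LEAST b. \<forall>m. h m < b)"
  have "\<exists>b. \<forall>m. h m < b"
    using countable_imp_strictly_bounded[of "range h"] by auto
  then have "\<forall>m. h m < d"
    unfolding d_def by (rule LeastI_ex)
  then have d: "h m < d" for m
    by blast
  have least: "\<exists>m. y \<le> h m" if "y < d" for y
    using not_less_Least[OF that[unfolded d_def]] by (auto simp: not_less)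
  have "d \<in> K n" for n
  proof -
    have "\<exists>y\<in>K n. z < y \<and> y < d" if "z < d" for z
    proof -
      obtain m where m: "z \<le> h m"
        using least \<open>z < d\<close> by blast
      define k where "k = prod_encode (n, m)"
      have "m \<le> k"
        unfolding k_def by (rule le_prod_encode_2)
      then have "z < h (Suc k)"
        using m mono by (meson le_imp_less_Suc le_less_trans strict_mono_less)
      moreover have "h (Suc k) \<in> K n"
        by (simp add: h_Suc k_def s)
      ultimately show ?thesis
        using d by blast
    qed
    moreover have "x < d"
      using d[of 0] h0 by simp
    ultimately show ?thesis
      using assms[of n] unfolding club_set_def by blast
  qed
  then show ?thesis
    using d[of 0] h0 by auto
qed

text \<open>If every \<open>U n\<close> missed a club, a common point of these clubs above
  \<open>x\<close> would be left uncovered.\<close>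

lemma stationary_in_countable_cover:
  assumes "\<And>y. x < y \<Longrightarrow> \<exists>n :: nat. y \<in> U n"
  shows "\<exists>n. stationary_set (U n)"
proof (rule ccontr)
  assume "\<not> ?thesis"
  then obtain K where "\<And>n. club_set (K n)" "\<And>n. U n \<inter> K n = {}"
    unfolding stationary_set_def by metis
  then show False
    using countable_club_Inter_unbounded[of K x] assms by blast
qed

text \<open>An Ulam matrix.\<close>
lemma stationary_partition:
  assumes CH
  shows "\<exists>t :: countable_ordinal \<Rightarrow> nat set. \<forall>r. stationary_set {x. t x = r}"
proof -
  define f where "f y = to_nat_on {..<y :: countable_ordinal}" for y
  have f: "inj_on (f y) {..<y}" for y
    unfolding f_def by (rule inj_on_to_nat_on[OF countable_lessThan])
  have "\<exists>n. stationary_set {y. x < y \<and> f y x = n}" for x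
    by (rule stationary_in_countable_cover[of x]) auto
  then obtain k where k: "\<And>x. stationary_set {y. x < y \<and> f y x = k x}"
    by metis
  \<comment> \<open>Uncountably many \<open>x\<close> share one value \<open>n\<close>. For these,
    the sets \<open>{y. x < y \<and> f y x = n}\<close> are stationary, and they are pairwise
    disjoint because each \<open>f y\<close> is injective.\<close>
  obtain n where n: "uncountable {x. k x = n}"
  proof (rule ccontr)
    assume "\<not> thesis"
    then have "countable (\<Union>n. {x. k x = n})"
      using that by (intro countable_UN) auto
    moreover have "(\<Union>n. {x. k x = n}) = UNIV"
      by auto
    ultimately show False
      using uncountable_countable_ordinal by simp
  qed
  obtain h :: "nat set \<Rightarrow> countable_ordinal" where h: "inj h" "range h \<subseteq> {x. k x = n}"
    using inj_reals_into_uncountable[OF assms n] by blast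
  \<comment> \<open>Injectivity of \<open>f y\<close> leaves at most one candidate \<open>r\<close>.
    Where there is none the value is arbitrary, which can only enlarge the classes of
    \<open>t\<close>.\<close>
  define t where "t y = (THE r. h r < y \<and> f y (h r) = n)" for y
  have t: "t y = r" if "h r < y" "f y (h r) = n" for y r
    unfolding t_def
  proof (rule the_equality)
    fix r' assume "h r' < y \<and> f y (h r') = n"
    then have "h r' = h r"
      using f[of y] that unfolding inj_on_def by auto
    then show "r' = r"
      using h(1) by (simp add: inj_eq)
  qed (use that in simp)
  have "stationary_set {x. t x = r}" for r
  proof -
    have "k (h r) = n"
      using h(2) by auto
    then have "{y. h r < y \<and> f y (h r) = k (h r)} \<subseteq> {x. t x = r}"
      using t by auto
    then show ?thesis
      using k[of "h r"] unfolding stationary_set_def by blast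
  qed
  then show ?thesis
    by blast
qed

section \<open>One step of the recursion\<close>

text \<open>The block of level \<^term>\<open>k\<close> has \<^term>\<open>k + 1\<close> elements, so sets meeting every block at
  most once cannot finitely cover infinitely many blocks.\<close>
definition level :: "nat \<Rightarrow> nat" where
  "level m = (case prod_decode m of (i, j) \<Rightarrow> i + j)"

lemma level_vimage: "level -` {k} = (\<lambda>i. prod_encode (i, k - i)) ` {..k}"
proof (intro set_eqI iffI)
  fix m assume "m \<in> level -` {k}"
  then show "m \<in> (\<lambda>i. prod_encode (i, k - i)) ` {..k}"
    by (intro image_eqI[where x = "fst (prod_decode m)"])
      (auto simp: level_def split: prod.splits dest: arg_cong[where f = prod_encode])
qed (auto simp: level_def)

lemma finite_level_vimage: "finite (level -` {k})"
  by (simp add: level_vimage)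

lemma card_level_vimage: "card (level -` {k}) = Suc k"
  unfolding level_vimage by (subst card_image) (auto simp: inj_on_def)

lemma finite_level_less: "finite {m. level m \<le> k}"
proof -
  have "{m. level m \<le> k} = (\<Union>i\<le>k. level -` {i})"
    by auto
  then show ?thesis
    by (simp add: finite_level_vimage)
qed

text \<open>A block of level at least \<open>card F\<close> has more than \<open>card F\<close>
  points, while each member of \<open>F\<close> covers at most one of them.\<close>

lemma infinite_level_diff_Union:
  assumes "infinite D" "finite F" "\<And>g. g \<in> F \<Longrightarrow> inj_on level g"
  shows "infinite (level -` D - \<Union>F)"
proof -
  have "\<exists>m. m \<in> level -` {k} - \<Union>F" if k: "k \<in> D \<inter> {card F..}" for k
  proof (rule ccontr)
    assume "\<not> ?thesis"
    then have sub: "level -` {k} \<subseteq> (\<Union>g\<in>F. g \<inter> level -` {k})"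
      by blast
    have "card (level -` {k}) \<le> card (\<Union>g\<in>F. g \<inter> level -` {k})"
      using sub assms(2) by (intro card_mono) (auto simp: finite_level_vimage)
    also have "\<dots> \<le> (\<Sum>g\<in>F. card (g \<inter> level -` {k}))"
      using assms(2) by (rule card_UN_le)
    also have "\<dots> \<le> (\<Sum>g\<in>F. 1)"
    proof (rule sum_mono)
      fix g assume "g \<in> F"
      then have "inj_on level (g \<inter> level -` {k})"
        using assms(3) inj_on_subset by blast
      moreover have "level ` (g \<inter> level -` {k}) \<subseteq> {k}"
        by auto
      ultimately show "card (g \<inter> level -` {k}) \<le> 1"
        using card_inj_on_le[of level "g \<inter> level -` {k}" "{k}"] by simp
    qed
    finally show False
      using k by (simp add: card_level_vimage)
  qed
  then have "D \<inter> {card F..} \<subseteq> level ` (level -` D - \<Union>F)"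
    by blast
  moreover have "D \<subseteq> (D \<inter> {card F..}) \<union> {..<card F}"
    by auto
  then have "infinite (D \<inter> {card F..})"
    using assms(1) infinite_super by (metis finite_Un finite_lessThan)
  ultimately show ?thesis
    using finite_subset by blast
qed

text \<open>Enumerate \<open>\<G>\<close> and choose \<open>e m\<close> in \<open>Y m\<close>
  outside the first \<open>m\<close> sets and in a higher block than before. The set number
  \<open>i\<close> can then contain \<open>e m\<close> only for \<open>m \<le> i\<close>.\<close>

lemma transversal_exists:
  fixes Y :: "nat \<Rightarrow> nat set"
  assumes "countable \<G>"
    and "\<And>m F. finite F \<Longrightarrow> F \<subseteq> \<G> \<Longrightarrow> infinite (Y m - \<Union>F)"
  shows "\<exists>e. (\<forall>m. e m \<in> Y m) \<and> strict_mono (level \<circ> e) \<and> (\<forall>g\<in>\<G>. finite {m. e m \<in> g})"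
proof -
  \<comment> \<open>Adding the empty set makes the enumeration onto even when \<open>\<G>\<close> is
    empty.\<close>
  define G where "G = from_nat_into (insert {} \<G>)"
  have G: "range G = insert {} \<G>"
    unfolding G_def using assms(1) by (intro range_from_nat_into) auto
  have inf: "infinite (Y m - (\<Union>i<n. G i))" for m n
  proof -
    have "(\<Union>i<n. G i) = \<Union>(G ` {..<n} - {{}})"
      by auto
    moreover have "G ` {..<n} - {{}} \<subseteq> \<G>"
      using equalityD1[OF G] by blast
    ultimately show ?thesis
      using assms(2)[of "G ` {..<n} - {{}}"] by simp
  qed
  have step: "\<exists>y. y \<in> Y m - (\<Union>i<m. G i) \<and> k < level y" for m k
  proof -
    have "infinite (Y m - (\<Union>i<m. G i) - {y. level y \<le> k})"
      using inf finite_level_less by (rule Diff_infinite_finite[rotated])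
    then obtain y where "y \<in> Y m - (\<Union>i<m. G i) - {y. level y \<le> k}"
      using infinite_imp_nonempty by blast
    then show ?thesis
      by (intro exI[of _ y]) simp
  qed
  have "\<exists>e. \<forall>m. e m \<in> Y m - (\<Union>i<m. G i) \<and> level (e m) < level (e (Suc m))"
  proof (rule dependent_nat_choice)
    show "\<exists>y. y \<in> Y 0 - (\<Union>i<0. G i)"
      using step[of 0 0] by blast
    show "\<exists>y. y \<in> Y (Suc m) - (\<Union>i<Suc m. G i) \<and> level x < level y" for m x
      using step[of "Suc m" "level x"] .
  qed
  then obtain e where e: "\<forall>m. e m \<in> Y m - (\<Union>i<m. G i) \<and> level (e m) < level (e (Suc m))" ..
  have e_in: "e m \<in> Y m" "e m \<notin> (\<Union>i<m. G i)" for m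
    using spec[OF e, of m] by blast+
  have "strict_mono (level \<circ> e)"
    unfolding strict_mono_Suc_iff comp_apply by (intro allI conjunct2[OF spec[OF e]])
  have "finite {m. e m \<in> g}" if "g \<in> \<G>" for g
  proof -
    have "g \<in> range G"
      using that G by simp
    then obtain i where "g = G i"
      by (rule rangeE)
    have "m \<le> i" if "e m \<in> g" for m
      using e_in(2)[of m] that \<open>g = G i\<close> by (metis UN_I lessThan_iff not_le)
    then have "{m. e m \<in> g} \<subseteq> {..i}"
      by blast
    then show ?thesis
      using finite_subset by blast
  qed
  with e_in(1) \<open>strict_mono (level \<circ> e)\<close> show ?thesis
    by (intro exI[of _ e] conjI allI ballI)
qed

text \<open>Asking for an infinite complement means that \<open>\<G>\<close> together with all
  finite sets generates a proper ideal.\<close>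

definition generates_proper_ideal :: "nat set set \<Rightarrow> bool" where
  "generates_proper_ideal \<G> \<longleftrightarrow> (\<forall>F. finite F \<and> F \<subseteq> \<G> \<longrightarrow> infinite (- \<Union>F))"

text \<open>Diagonalizing against \<open>\<G>\<close> gives an infinite \<open>range e\<close> that
  meets every generator in a finite set. Adding \<open>X\<close> is safe once
  \<open>range e - X\<close> is infinite, and two disjoint sets cannot both contain almost all of
  \<open>range e\<close>.\<close>

lemma generates_proper_ideal_insert_disjoint:
  assumes "countable \<G>" "generates_proper_ideal \<G>" "A \<inter> B = {}"
  shows "generates_proper_ideal (insert A \<G>) \<or> generates_proper_ideal (insert B \<G>)"
proof -
  have "\<exists>e. (\<forall>m::nat. e m \<in> (UNIV :: nat set)) \<and> strict_mono (level \<circ> e) \<and> (\<forall>g\<in>\<G>. finite {m. e m \<in> g})"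
    using assms(1,2) by (intro transversal_exists) (auto simp: generates_proper_ideal_def Compl_eq_Diff_UNIV[symmetric])
  then obtain e :: "nat \<Rightarrow> nat" where e: "strict_mono (level \<circ> e)" "\<And>g. g \<in> \<G> \<Longrightarrow> finite {m. e m \<in> g}"
    by blast
  have "inj e"
    using e(1) inj_on_imageI2 strict_mono_imp_inj_on by blast
  then have inf: "infinite (range e)"
    using finite_imageD by blast
  have "range e \<inter> g = e ` {m. e m \<in> g}" for g
    by auto
  then have fin: "finite (range e \<inter> g)" if "g \<in> \<G>" for g
    using e(2)[OF that] by simp
  have key: "generates_proper_ideal (insert X \<G>)" if X: "infinite (range e - X)" for X
    unfolding generates_proper_ideal_def
  proof (intro allI impI)
    fix F assume F: "finite F \<and> F \<subseteq> insert X \<G>"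
    have "finite (\<Union>g\<in>F - {X}. range e \<inter> g)"
      using F fin by (intro finite_UN_I) auto
    with X have "infinite (range e - X - (\<Union>g\<in>F - {X}. range e \<inter> g))"
      by (rule Diff_infinite_finite[rotated])
    moreover have "range e - X - (\<Union>g\<in>F - {X}. range e \<inter> g) \<subseteq> - \<Union>F"
      by auto
    ultimately show "infinite (- \<Union>F)"
      using finite_subset by blast
  qed
  have "range e = (range e - A) \<union> (range e - B)"
    using assms(3) by auto
  then have "infinite (range e - A) \<or> infinite (range e - B)"
    using inf by (metis finite_Un)
  then show ?thesis
    using key by blast
qed

text \<open>A transversal for \<open>\<H>\<close> is split by parity of the index. Both halves meet
  all \<open>Y n\<close> infinitely often, and being disjoint, one of them can be added to
  \<open>\<G>\<close>.\<close>

lemma selector_exists: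
  fixes Y :: "nat \<Rightarrow> nat set"
  assumes "countable \<G>" "generates_proper_ideal \<G>" "\<H> \<subseteq> \<G>"
    and "\<forall>n F. finite F \<longrightarrow> F \<subseteq> \<H> \<longrightarrow> infinite (Y n - \<Union>F)"
  shows "\<exists>a. inj_on level a \<and> a \<subseteq> \<Union>(range Y) \<and> (\<forall>n. infinite (a \<inter> Y n)) \<and>
    (\<forall>g\<in>\<H>. finite (a \<inter> g)) \<and> generates_proper_ideal (insert a \<G>)"
proof -
  \<comment> \<open>Halving \<open>m\<close> before decoding makes each \<open>Y n\<close> the
    target at infinitely many even and infinitely many odd \<open>m\<close>.\<close>
  define Z where "Z m = Y (fst (prod_decode (m div 2)))" for m
  have "\<exists>e. (\<forall>m. e m \<in> Z m) \<and> strict_mono (level \<circ> e) \<and> (\<forall>g\<in>\<H>. finite {m. e m \<in> g})"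
    using assms(1,3,4) by (intro transversal_exists) (auto simp: Z_def countable_subset)
  then obtain e where e: "\<And>m. e m \<in> Z m" "strict_mono (level \<circ> e)" "\<And>g. g \<in> \<H> \<Longrightarrow> finite {m. e m \<in> g}"
    by blast
  have inj: "inj (level \<circ> e)"
    using e(2) strict_mono_imp_inj_on by blast
  then have "inj e"
    using inj_on_imageI2 by blast
  define M where "M i = {m. m mod 2 = (i::nat)}" for i
  have sel: "inj_on level (e ` M i) \<and> e ` M i \<subseteq> \<Union>(range Y) \<and> (\<forall>n. infinite (e ` M i \<inter> Y n)) \<and>
      (\<forall>g\<in>\<H>. finite (e ` M i \<inter> g))" if "i < 2" for i
  proof (intro conjI allI ballI)
    show "inj_on level (e ` M i)"
      using inj by (auto simp: inj_on_def)
    show "e ` M i \<subseteq> \<Union>(range Y)"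
      using e(1) by (auto simp: Z_def)
    show "finite (e ` M i \<inter> g)" if "g \<in> \<H>" for g
      using e(3)[OF that] by (rule finite_surj[where f = e]) auto
    fix n
    define c where "c k = e (2 * prod_encode (n, k) + i)" for k
    have "c k \<in> e ` M i \<inter> Y n" for k
    proof -
      have "c k \<in> Z (2 * prod_encode (n, k) + i)"
        unfolding c_def by (rule e(1))
      then show ?thesis
        using \<open>i < 2\<close> by (auto simp: Z_def c_def M_def)
    qed
    moreover have "inj c"
      by (rule injI) (simp add: c_def inj_eq[OF \<open>inj e\<close>])
    ultimately show "infinite (e ` M i \<inter> Y n)"
      by (meson image_subsetI infinite_iff_countable_subset)
  qed
  have "M 0 \<inter> M 1 = {}"
    by (auto simp: M_def)
  then have "e ` M 0 \<inter> e ` M 1 = {}"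
    using \<open>inj e\<close> by (simp add: image_Int[symmetric])
  from generates_proper_ideal_insert_disjoint[OF assms(1,2) this] show ?thesis
    using sel[of 0] sel[of 1] by auto
qed

section \<open>Index sets that decide traces\<close>

definition decides :: "nat set \<Rightarrow> nat set \<Rightarrow> bool" where
  "decides I J \<longleftrightarrow> finite (I \<inter> J) \<or> finite (I - J)"

text \<open>A countable family is not splitting: shrink an infinite set to decide one
  \<open>J k\<close> after another, then take a pseudo-intersection of the decreasing
  sequence.\<close>

lemma deciding_set_exists:
  fixes J :: "nat \<Rightarrow> nat set"
  shows "\<exists>I. infinite I \<and> (\<forall>k. decides I (J k))"
proof -
  have "\<exists>K. \<forall>n. infinite (K n) \<and> (K (Suc n) \<subseteq> K n \<and> (K (Suc n) \<subseteq> J n \<or> K (Suc n) \<inter> J n = {}))"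
  proof (rule dependent_nat_choice)
    show "\<exists>x :: nat set. infinite x"
      by auto
    fix x :: "nat set" and n assume "infinite x"
    moreover have "x = (x \<inter> J n) \<union> (x - J n)"
      by auto
    ultimately have "infinite (x \<inter> J n) \<or> infinite (x - J n)"
      by (metis finite_Un)
    then show "\<exists>y. infinite y \<and> y \<subseteq> x \<and> (y \<subseteq> J n \<or> y \<inter> J n = {})"
    proof
      assume "infinite (x \<inter> J n)"
      then show ?thesis
        by (intro exI[of _ "x \<inter> J n"]) auto
    next
      assume "infinite (x - J n)"
      then show ?thesis
        by (intro exI[of _ "x - J n"]) auto
    qed
  qed
  then obtain K where K: "\<And>n. infinite (K n)" "\<And>n. K (Suc n) \<subseteq> K n"
      "\<And>n. K (Suc n) \<subseteq> J n \<or> K (Suc n) \<inter> J n = {}"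
    by blast
  \<comment> \<open>The strictly growing levels are what makes \<open>e\<close> injective.\<close>
  have "\<exists>e. (\<forall>m. e m \<in> K m) \<and> strict_mono (level \<circ> e) \<and> (\<forall>g\<in>{}. finite {m. e m \<in> g})"
    using K(1) by (intro transversal_exists) auto
  then obtain e where e: "\<And>m. e m \<in> K m" "strict_mono (level \<circ> e)"
    by blast
  have "inj e"
    using e(2) inj_on_imageI2 strict_mono_imp_inj_on by blast
  then have "infinite (range e)"
    using finite_imageD by blast
  moreover have "decides (range e) (J k)" for k
  proof -
    have "e m \<in> K (Suc k)" if "m > k" for m
      using e(1)[of m] lift_Suc_antimono_le[of K "Suc k" m] K(2) that by auto
    then have "range e - K (Suc k) \<subseteq> e ` {..k}"
      by (force simp: not_less)
    then have "finite (range e - K (Suc k))"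
      using finite_subset by blast
    moreover have "range e - J k \<subseteq> range e - K (Suc k) \<or> range e \<inter> J k \<subseteq> range e - K (Suc k)"
      using K(3)[of k] by blast
    ultimately show ?thesis
      unfolding decides_def using finite_subset by blast
  qed
  ultimately show ?thesis
    by blast
qed

lemma infinite_split:
  fixes I :: "nat set"
  assumes "infinite I"
  shows "\<exists>I1 I2. infinite I1 \<and> infinite I2 \<and> I1 \<subseteq> I \<and> I2 \<subseteq> I \<and> I1 \<inter> I2 = {}"
proof -
  let ?e = "enumerate I"
  have inj: "inj ?e"
    using assms strict_mono_enumerate strict_mono_imp_inj_on by blast
  have "inj (\<lambda>n. ?e (2 * n))" "inj (\<lambda>n. ?e (Suc (2 * n)))"
    by (rule injI, simp add: inj_eq[OF inj])+
  then have "infinite (range (\<lambda>n. ?e (2 * n)))" "infinite (range (\<lambda>n. ?e (Suc (2 * n))))"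
    by (simp_all add: range_inj_infinite)
  moreover have "range (\<lambda>n. ?e (2 * n)) \<inter> range (\<lambda>n. ?e (Suc (2 * n))) = {}"
    by (auto simp: inj_eq[OF inj] double_not_eq_Suc_double)
  moreover have "range (\<lambda>n. ?e (2 * n)) \<subseteq> I" "range (\<lambda>n. ?e (Suc (2 * n))) \<subseteq> I"
    using enumerate_in_set[OF assms] by auto
  ultimately show ?thesis
    by (intro exI conjI)
qed

definition trace :: "(nat \<Rightarrow> nat set) \<Rightarrow> nat set \<Rightarrow> nat set" where
  "trace C a = {n. a \<inter> C n \<noteq> {}}"

text \<open>Any infinite subset of a deciding set still decides. Two disjoint halves have disjoint
  unions along \<open>C\<close>, so one of these unions can be added to \<open>\<G>\<close>.\<close>

lemma deciding_index_set_exists: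
  assumes "fin_sequence C" "countable \<G>" "generates_proper_ideal \<G>" "\<H> \<subseteq> \<G>"
  shows "\<exists>I. infinite I \<and> (\<forall>g\<in>\<H>. decides I (trace C g)) \<and>
    generates_proper_ideal (insert (\<Union>n\<in>I. C n) \<G>)"
proof -
  define G where "G = from_nat_into (insert {} \<H>)"
  have G: "range G = insert {} \<H>"
    unfolding G_def using countable_subset[OF assms(4,2)] by (intro range_from_nat_into) auto
  obtain I where I: "infinite I" "\<And>k. decides I (trace C (G k))"
    using deciding_set_exists[of "\<lambda>k. trace C (G k)"] by blast
  have dec: "decides I (trace C g)" if "g \<in> \<H>" for g
    using G I(2) that by (metis insertCI rangeE)
  obtain I1 I2 where I12: "infinite I1" "infinite I2" "I1 \<subseteq> I" "I2 \<subseteq> I" "I1 \<inter> I2 = {}"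
    using infinite_split[OF I(1)] by blast
  have sub: "decides I' (trace C g)" if "I' \<subseteq> I" "g \<in> \<H>" for I' g
    using dec[OF that(2)] finite_subset[OF Int_mono[OF that(1) subset_refl]]
      finite_subset[OF Diff_mono[OF that(1) subset_refl]] unfolding decides_def by blast
  have "(\<Union>n\<in>I1. C n) \<inter> (\<Union>n\<in>I2. C n) = {}"
  proof -
    have "C n \<inter> C m = {}" if "n \<in> I1" "m \<in> I2" for n m
      using assms(1) I12(5) that unfolding fin_sequence_def by (metis disjoint_iff)
    then show ?thesis
      by blast
  qed
  from generates_proper_ideal_insert_disjoint[OF assms(2,3) this] show ?thesis
    using I12 sub by blast
qed

section \<open>The recursion\<close>

text \<open>A finite subfamily draws on finitely many stages, hence on those up to a single stage
  below \<open>x\<close>. Successors and limits are treated alike.\<close>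

lemma generates_proper_ideal_chain:
  fixes \<G> :: "'a :: linorder \<Rightarrow> nat set set"
  assumes "\<And>y. y < x \<Longrightarrow> generates_proper_ideal (\<Union>z\<in>{..y}. \<G> z)"
  shows "generates_proper_ideal (\<Union>z\<in>{..<x}. \<G> z)"
  unfolding generates_proper_ideal_def
proof (intro allI impI)
  fix F assume F: "finite F \<and> F \<subseteq> (\<Union>z\<in>{..<x}. \<G> z)"
  show "infinite (- \<Union>F)"
  proof (cases "F = {}")
    case False
    have "\<forall>g\<in>F. \<exists>z. z < x \<and> g \<in> \<G> z"
      using F by blast
    then obtain i where i: "\<And>g. g \<in> F \<Longrightarrow> i g < x \<and> g \<in> \<G> (i g)"
      by metis
    have fin: "finite (i ` F)" "i ` F \<noteq> {}"
      using F False by auto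
    then have "Max (i ` F) < x"
      using i by auto
    moreover have "F \<subseteq> (\<Union>z\<in>{..Max (i ` F)}. \<G> z)"
    proof
      fix g assume "g \<in> F"
      then have "i g \<in> {..Max (i ` F)}" "g \<in> \<G> (i g)"
        using i fin by auto
      then show "g \<in> (\<Union>z\<in>{..Max (i ` F)}. \<G> z)"
        by (rule UN_I)
    qed
    ultimately show ?thesis
      using assms F unfolding generates_proper_ideal_def by blast
  qed simp
qed

text \<open>The ordinals with task \<^term>\<open>None\<close> will form the stationary set whose family is
  fin-intersecting. The other two requirements are both met through tasks \<^term>\<open>Some Y\<close>.\<close>
lemma family_exists:
  fixes task :: "countable_ordinal \<Rightarrow> (nat \<Rightarrow> nat set) option"
    and C :: "countable_ordinal \<Rightarrow> nat \<Rightarrow> nat set"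
  assumes C: "\<And>x. fin_sequence (C x)"
  shows "\<exists>A I. \<forall>x. infinite (A x) \<and> inj_on level (A x) \<and> (\<forall>y<x. finite (A x \<inter> A y)) \<and>
    infinite (I x) \<and> (\<forall>y\<le>x. decides (I x) (trace (C x) (A y))) \<and>
    (case task x of
      None \<Rightarrow> \<forall>y<x. finite (A x \<inter> (\<Union>n\<in>I y. C y n))
    | Some Y \<Rightarrow> (\<forall>n F. finite F \<longrightarrow> F \<subseteq> A ` {..<x} \<longrightarrow> infinite (Y n - \<Union>F)) \<longrightarrow>
        A x \<subseteq> \<Union>(range Y) \<and> (\<forall>n. infinite (A x \<inter> Y n)))"
proof -
  \<comment> \<open>Each stage contributes two generators: its member of the family and the union of
    its fin sequence along the chosen index set.\<close>
  define gens :: "countable_ordinal \<Rightarrow> nat set \<times> nat set \<Rightarrow> nat set set"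
    where "gens y r = {fst r, \<Union>n\<in>snd r. C y n}" for y r
  \<comment> \<open>\<open>P f x r\<close> admits \<open>r\<close> as stage \<open>x\<close> and
    consults \<open>f\<close> only below \<open>x\<close>, as the recursion principle demands. The
    clause on \<open>generates_proper_ideal\<close> is the invariant that keeps later stages
    possible.\<close>
  define P :: "(countable_ordinal \<Rightarrow> nat set \<times> nat set) \<Rightarrow> countable_ordinal \<Rightarrow> nat set \<times> nat set \<Rightarrow> bool"
    where "P f x r \<longleftrightarrow> inj_on level (fst r) \<and> infinite (fst r) \<and>
      (\<forall>y<x. finite (fst r \<inter> fst (f y))) \<and>
      infinite (snd r) \<and> (\<forall>y<x. decides (snd r) (trace (C x) (fst (f y)))) \<and>
      decides (snd r) (trace (C x) (fst r)) \<and>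
      generates_proper_ideal (gens x r \<union> (\<Union>y\<in>{..<x}. gens y (f y))) \<and>
      (case task x of
        None \<Rightarrow> \<forall>y<x. finite (fst r \<inter> (\<Union>n\<in>snd (f y). C y n))
      | Some Y \<Rightarrow> (\<forall>n F. finite F \<longrightarrow> F \<subseteq> (\<lambda>y. fst (f y)) ` {..<x} \<longrightarrow> infinite (Y n - \<Union>F)) \<longrightarrow>
          fst r \<subseteq> \<Union>(range Y) \<and> (\<forall>n. infinite (fst r \<inter> Y n)))" for f x r
  have "\<exists>f. \<forall>x. P f x (f x)"
  proof (rule dependent_wf_choice[OF wf])
    fix f g :: "countable_ordinal \<Rightarrow> nat set \<times> nat set" and x r
    assume "\<And>z. (z, x) \<in> {(x, y). x < y} \<Longrightarrow> f z = g z"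
    then have eq: "f z = g z" if "z < x" for z
      using that by simp
    have "(\<lambda>y. fst (f y)) ` {..<x} = (\<lambda>y. fst (g y)) ` {..<x}"
      "(\<Union>y\<in>{..<x}. gens y (f y)) = (\<Union>y\<in>{..<x}. gens y (g y))"
      using eq by auto
    then show "P f x r = P g x r"
      unfolding P_def using eq by (simp cong: option.case_cong)
  next
    fix x f
    assume "\<And>y. (y, x) \<in> {(x, y). x < y} \<Longrightarrow> P f y (f y)"
    then have IH: "P f y (f y)" if "y < x" for y
      using that by simp
    define \<H> where "\<H> = (\<lambda>y. fst (f y)) ` {..<x}"
    define \<G> where "\<G> = (\<Union>y\<in>{..<x}. gens y (f y))"
    have sub: "\<H> \<subseteq> \<G>"
      unfolding \<H>_def \<G>_def gens_def by blast
    have count: "countable \<G>"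
      unfolding \<G>_def gens_def by (intro countable_UN countable_lessThan) simp
    have proper: "generates_proper_ideal \<G>"
      unfolding \<G>_def
    proof (rule generates_proper_ideal_chain)
      fix y assume "y < x"
      then have "generates_proper_ideal (gens y (f y) \<union> (\<Union>y\<in>{..<y}. gens y (f y)))"
        using IH unfolding P_def by blast
      moreover have "{..y} = insert y {..<y}"
        by auto
      ultimately show "generates_proper_ideal (\<Union>z\<in>{..y}. gens z (f z))"
        by simp
    qed
    \<comment> \<open>With all naturals as constant target, the selection lemma yields a set almost
      disjoint from the whole of \<open>\<G>\<close>.\<close>
    have UNIV_pos: "\<forall>(n :: nat) F. finite F \<longrightarrow> F \<subseteq> \<G> \<longrightarrow> infinite (UNIV - \<Union>F)"
      using proper by (simp add: generates_proper_ideal_def Compl_eq_Diff_UNIV[symmetric])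
    obtain a where a: "inj_on level a" "infinite a" "\<And>g. g \<in> \<H> \<Longrightarrow> finite (a \<inter> g)"
        "generates_proper_ideal (insert a \<G>)"
        and task: "case task x of
          None \<Rightarrow> \<forall>g\<in>\<G>. finite (a \<inter> g)
        | Some Y \<Rightarrow> (\<forall>n F. finite F \<longrightarrow> F \<subseteq> \<H> \<longrightarrow> infinite (Y n - \<Union>F)) \<longrightarrow>
            a \<subseteq> \<Union>(range Y) \<and> (\<forall>n. infinite (a \<inter> Y n))"
    \<comment> \<open>When a task is carried out, its targets are positive over \<open>\<H>\<close>
      only and may be covered by other generators, so almost disjointness is secured just from
      \<open>\<H>\<close>. In all other cases it is secured from \<open>\<G>\<close>, as
      \<open>None\<close> requires.\<close>
    proof (cases "\<exists>Y. task x = Some Y \<and> (\<forall>n F. finite F \<longrightarrow> F \<subseteq> \<H> \<longrightarrow> infinite (Y n - \<Union>F))")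
      case True
      then obtain Y where Y: "task x = Some Y"
          "\<forall>n F. finite F \<longrightarrow> F \<subseteq> \<H> \<longrightarrow> infinite (Y n - \<Union>F)"
        by (elim exE conjE)
      obtain a where a: "inj_on level a" "a \<subseteq> \<Union>(range Y)" "\<And>n. infinite (a \<inter> Y n)"
          "\<And>g. g \<in> \<H> \<Longrightarrow> finite (a \<inter> g)" "generates_proper_ideal (insert a \<G>)"
        using selector_exists[OF count proper sub Y(2)]
        by (elim exE conjE) (rule that, simp_all)
      moreover have "infinite a"
        using a(3)[of 0] by (rule contrapos_nn) simp
      ultimately show ?thesis
        by (intro that[of a]) (simp_all add: Y(1))
    next
      case False
      obtain a where a: "inj_on level a" "infinite a"
          "\<And>g. g \<in> \<G> \<Longrightarrow> finite (a \<inter> g)" "generates_proper_ideal (insert a \<G>)"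
        using selector_exists[OF count proper subset_refl UNIV_pos]
        by (elim exE conjE) (rule that, simp_all)
      show ?thesis
      proof (rule that[of a])
        show "finite (a \<inter> g)" if "g \<in> \<H>" for g
          using a(3) subsetD[OF sub that] .
        show "case task x of None \<Rightarrow> \<forall>g\<in>\<G>. finite (a \<inter> g)
          | Some Y \<Rightarrow> (\<forall>n F. finite F \<longrightarrow> F \<subseteq> \<H> \<longrightarrow> infinite (Y n - \<Union>F)) \<longrightarrow>
            a \<subseteq> \<Union>(range Y) \<and> (\<forall>n. infinite (a \<inter> Y n))"
          using False a(3) by (cases "task x") auto
      qed (use a in simp_all)
    qed
    \<comment> \<open>\<open>I\<close> is chosen after \<open>a\<close>, so that it also decides the
      trace of the member of its own stage.\<close>
    have count': "countable (insert a \<G>)" and sub': "insert a \<H> \<subseteq> insert a \<G>"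
      using count sub by auto
    obtain I where I: "infinite I" "\<And>g. g \<in> insert a \<H> \<Longrightarrow> decides I (trace (C x) g)"
        "generates_proper_ideal (insert (\<Union>n\<in>I. C x n) (insert a \<G>))"
      using deciding_index_set_exists[OF C[of x] count' a(4) sub']
      by (elim exE conjE) (rule that, assumption, rule bspec, assumption+)
    have "insert (\<Union>n\<in>I. C x n) (insert a \<G>) = gens x (a, I) \<union> \<G>"
      unfolding gens_def by auto
    then have "generates_proper_ideal (gens x (a, I) \<union> \<G>)"
      using I(3) by simp
    moreover have "case task x of
        None \<Rightarrow> \<forall>y<x. finite (a \<inter> (\<Union>n\<in>snd (f y). C y n))
      | Some Y \<Rightarrow> (\<forall>n F. finite F \<longrightarrow> F \<subseteq> \<H> \<longrightarrow> infinite (Y n - \<Union>F)) \<longrightarrow>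
          a \<subseteq> \<Union>(range Y) \<and> (\<forall>n. infinite (a \<inter> Y n))"
    proof (cases "task x")
      case None
      have "(\<Union>n\<in>snd (f y). C y n) \<in> \<G>" if "y < x" for y
        using that unfolding \<G>_def gens_def by blast
      then show ?thesis
        using None task by simp
    next
      case (Some Y)
      then show ?thesis
        using task by simp
    qed
    moreover have "finite (a \<inter> fst (f y))" "decides I (trace (C x) (fst (f y)))" if "y < x" for y
      using a(3) I(2) that by (simp_all add: \<H>_def)
    ultimately have "P f x (a, I)"
      unfolding P_def \<H>_def[symmetric] \<G>_def[symmetric] fst_conv snd_conv
      using a(1,2) I(1,2) by simp
    then show "\<exists>r. P f x r" ..
  qed
  then obtain f where "\<forall>x. P f x (f x)" ..
  then have f: "P f x (f x)" for x ..
  show ?thesis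
  proof (rule exI[of _ "\<lambda>x. fst (f x)"], rule exI[of _ "\<lambda>x. snd (f x)"], rule allI)
    fix x
    have "\<forall>y\<le>x. decides (snd (f x)) (trace (C x) (fst (f y)))"
      using f[of x] unfolding P_def by (auto simp: le_less)
    then show "infinite (fst (f x)) \<and> inj_on level (fst (f x)) \<and> (\<forall>y<x. finite (fst (f x) \<inter> fst (f y))) \<and>
      infinite (snd (f x)) \<and> (\<forall>y\<le>x. decides (snd (f x)) (trace (C x) (fst (f y)))) \<and>
      (case task x of
        None \<Rightarrow> \<forall>y<x. finite (fst (f x) \<inter> (\<Union>n\<in>snd (f y). C y n))
      | Some Y \<Rightarrow> (\<forall>n F. finite F \<longrightarrow> F \<subseteq> (\<lambda>x. fst (f x)) ` {..<x} \<longrightarrow> infinite (Y n - \<Union>F)) \<longrightarrow>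
          fst (f x) \<subseteq> \<Union>(range Y) \<and> (\<forall>n. infinite (fst (f x) \<inter> Y n)))"
      using f[of x] unfolding P_def by blast
  qed
qed

section \<open>The family\<close>

text \<open>Lets one real code a whole sequence of sets, so that the values of \<open>t\<close> can
  carry tasks and fin sequences.\<close>

definition rows :: "nat set \<Rightarrow> nat \<Rightarrow> nat set" where
  "rows r n = {k. prod_encode (n, k) \<in> r}"

lemma surj_rows: "\<exists>r. rows r = Y"
  by (rule exI[of _ "{m. snd (prod_decode m) \<in> Y (fst (prod_decode m))}"]) (auto simp: rows_def fun_eq_iff)

lemma club_set_UNIV: "club_set UNIV"
  unfolding club_set_def using countable_imp_strictly_bounded[of "{_}"] by auto

lemma infinite_Diff_ad_positive:
  "X \<in> ad_positive \<A> \<Longrightarrow> finite F \<Longrightarrow> F \<subseteq> \<A> \<Longrightarrow> infinite (X - \<Union>F)"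
  unfolding ad_positive_def ad_ideal_def almost_subset_def by blast

text \<open>Each point lies in at most one \<open>C n\<close>, so finitely many points account for
  finitely many indices.\<close>

lemma finite_indices_meeting:
  assumes "fin_sequence C" "finite (a \<inter> (\<Union>n\<in>I. C n))"
  shows "finite {n \<in> I. a \<inter> C n \<noteq> {}}"
proof -
  have "finite {n. m \<in> C n}" for m
  proof (cases "\<exists>n. m \<in> C n")
    case True
    then obtain n where "m \<in> C n" ..
    then have "{n. m \<in> C n} \<subseteq> {n}"
      using assms(1) unfolding fin_sequence_def by blast
    then show ?thesis
      using finite_subset by blast
  qed simp
  then have "finite (\<Union>m\<in>a \<inter> (\<Union>n\<in>I. C n). {n. m \<in> C n})"
    using assms(2) by blast
  then show ?thesis
    by (rule rev_finite_subset) blast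
qed

lemma centered_almost_full:
  assumes "infinite I" "\<And>J. J \<in> \<F> \<Longrightarrow> finite (I - J)"
  shows "centered \<F>"
  unfolding centered_def
proof (intro allI impI)
  fix \<B> assume \<B>: "finite \<B> \<and> \<B> \<noteq> {} \<and> \<B> \<subseteq> \<F>"
  have "finite (\<Union>J\<in>\<B>. I - J)"
    using \<B> assms(2) by (intro finite_UN_I) auto
  then have "infinite (I - (\<Union>J\<in>\<B>. I - J))"
    using assms(1) by (rule Diff_infinite_finite)
  moreover have "I - (\<Union>J\<in>\<B>. I - J) \<subseteq> \<Inter>\<B>"
    by auto
  ultimately show "infinite (\<Inter>\<B>)"
    using finite_subset by blast
qed

lemma fin_sequence_level: "fin_sequence (\<lambda>k. level -` {k})"
  unfolding fin_sequence_def
proof (intro conjI allI impI)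
  show "level -` {n} \<noteq> {}" for n
    using card_level_vimage[of n] by force
qed (auto simp: finite_level_vimage)

text \<open>Tightness and the failure on clubs both come from the fact \<open>hit\<close>, applied
  to the club \<open>UNIV\<close> and to the given club.\<close>

lemma family_on_countable_ordinals:
  assumes CH
  shows "\<exists>A :: countable_ordinal \<Rightarrow> nat set. inj A \<and> tight_MAD (range A) \<and>
    (\<forall>K. club_set K \<longrightarrow> \<not> fin_intersecting (A ` K)) \<and>
    (\<exists>S. stationary_set S \<and> fin_intersecting (A ` S))"
proof -
  obtain t :: "countable_ordinal \<Rightarrow> nat set" where "\<forall>r. stationary_set {x. t x = r}"
    using stationary_partition[OF assms] ..
  then have t: "stationary_set {x. t x = r}" for r ..
  have t_in_club: "\<exists>x\<in>K. rows (t x) = Y" if "club_set K" for K Y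
  proof -
    obtain r where "rows r = Y"
      using surj_rows ..
    then show ?thesis
      using t[of r] that unfolding stationary_set_def by blast
  qed
  \<comment> \<open>The set \<^term>\<open>t x\<close> is read in two independent ways: as a task, whose kind is given
    by row 0, and as a fin sequence.\<close>
  define task where "task x = (if rows (t x) 0 = {} then None else Some (\<lambda>n. rows (t x) (Suc n)))" for x
  define C where "C x = (if fin_sequence (rows (t x)) then rows (t x) else (\<lambda>n. {n}))" for x
  \<comment> \<open>Singletons are the default for reals that do not code a fin sequence.\<close>
  have "fin_sequence (\<lambda>n. {n})"
    by (simp add: fin_sequence_def)
  then have C: "fin_sequence (C x)" for x
    by (simp add: C_def)
  obtain A I where AI: "\<forall>x. infinite (A x) \<and> inj_on level (A x) \<and> (\<forall>y<x. finite (A x \<inter> A y)) \<and>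
    infinite (I x) \<and> (\<forall>y\<le>x. decides (I x) (trace (C x) (A y))) \<and>
    (case task x of
      None \<Rightarrow> \<forall>y<x. finite (A x \<inter> (\<Union>n\<in>I y. C y n))
    | Some Y \<Rightarrow> (\<forall>n F. finite F \<longrightarrow> F \<subseteq> A ` {..<x} \<longrightarrow> infinite (Y n - \<Union>F)) \<longrightarrow>
        A x \<subseteq> \<Union>(range Y) \<and> (\<forall>n. infinite (A x \<inter> Y n)))"
    using family_exists[of C task, OF C] by (elim exE)
  then have inf: "infinite (A x)" and sel: "inj_on level (A x)"
    and ad_less: "y < x \<Longrightarrow> finite (A x \<inter> A y)" and infI: "infinite (I x)"
    and dec: "y \<le> x \<Longrightarrow> decides (I x) (trace (C x) (A y))" for x y
    by simp_all
  have avoid: "finite (A x \<inter> (\<Union>n\<in>I y. C y n))" if "task x = None" "y < x" for x y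
    using spec[OF AI, of x] that by simp
  \<comment> \<open>The code \<open>case_nat {0} Y\<close> has nonempty row 0 and so yields the task
    \<open>Some Y\<close>; every club contains an ordinal carrying it. Positivity over the whole
    range implies positivity over the earlier members.\<close>
  have hit: "\<exists>x\<in>K. A x \<subseteq> \<Union>(range Y) \<and> (\<forall>n. infinite (A x \<inter> Y n))"
    if K: "club_set K" and pos: "\<forall>n F. finite F \<longrightarrow> F \<subseteq> range A \<longrightarrow> infinite (Y n - \<Union>F)"
    for K and Y :: "nat \<Rightarrow> nat set"
  proof -
    obtain x where x: "x \<in> K" "rows (t x) = case_nat {0} Y"
      using t_in_club[OF K] by blast
    then have "task x = Some Y"
      by (simp add: task_def)
    moreover have "\<forall>n F. finite F \<longrightarrow> F \<subseteq> A ` {..<x} \<longrightarrow> infinite (Y n - \<Union>F)"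
      using pos by (meson image_mono order_trans subset_UNIV)
    ultimately have "A x \<subseteq> \<Union>(range Y) \<and> (\<forall>n. infinite (A x \<inter> Y n))"
      using spec[OF AI, of x] by simp
    then show ?thesis
      using x(1) by (rule bexI)
  qed
  have ad: "finite (A x \<inter> A y)" if "x \<noteq> y" for x y
    using ad_less[of x y] ad_less[of y x] that by (auto simp: neq_iff Int_commute)
  have inj: "inj A"
    by (rule injI) (metis Int_absorb ad inf)
  have "infinite (UNIV :: countable_ordinal set)"
    using uncountable_countable_ordinal countable_finite by blast
  then have "infinite (range A)"
    using inj finite_imageD by blast
  moreover have "finite (a \<inter> b)" if "a \<in> range A" "b \<in> range A" "a \<noteq> b" for a b
    using that ad by (elim rangeE) metis
  ultimately have "almost_disjoint (range A)"
    unfolding almost_disjoint_def using inf by blast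
  moreover have "\<exists>a\<in>range A. \<forall>n. infinite (a \<inter> X n)" if "\<forall>n. X n \<in> ad_positive (range A)"
    for X :: "nat \<Rightarrow> nat set"
  proof -
    have "\<forall>n F. finite F \<longrightarrow> F \<subseteq> range A \<longrightarrow> infinite (X n - \<Union>F)"
      by (intro allI impI infinite_Diff_ad_positive[OF spec[OF that]])
    from hit[OF club_set_UNIV this] show ?thesis
      by auto
  qed
  ultimately have "tight_MAD (range A)"
    unfolding tight_MAD_def by blast
  moreover have "\<not> fin_intersecting (A ` K)" if K: "club_set K" for K
  proof
    assume "fin_intersecting (A ` K)"
    moreover have "fin_sequence (\<lambda>k. level -` {k})"
      by (rule fin_sequence_level)
    ultimately obtain J :: "nat set" where J: "infinite J"
      "centered ((\<lambda>a. {n \<in> J. a \<inter> level -` {n} \<noteq> {}}) ` (A ` K) - {L. L \<subseteq> J \<and> finite L})"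
      unfolding fin_intersecting_def by (elim allE impE exE conjE)
    obtain J1 J2 where J12: "infinite J1" "infinite J2" "J1 \<subseteq> J" "J2 \<subseteq> J" "J1 \<inter> J2 = {}"
      using infinite_split[OF J(1)] by blast
    have sub: "\<exists>x\<in>K. A x \<subseteq> level -` D" if "infinite D" for D
    proof -
      have "\<forall>(n :: nat) F. finite F \<longrightarrow> F \<subseteq> range A \<longrightarrow> infinite (level -` D - \<Union>F)"
        using sel by (intro allI impI infinite_level_diff_Union[OF \<open>infinite D\<close>]) auto
      from hit[OF K this] show ?thesis
        by auto
    qed
    obtain x1 x2 where x: "x1 \<in> K" "x2 \<in> K" "A x1 \<subseteq> level -` J1" "A x2 \<subseteq> level -` J2"
      using sub[OF J12(1)] sub[OF J12(2)] by blast
    have mem: "level ` A x \<in> (\<lambda>a. {n \<in> J. a \<inter> level -` {n} \<noteq> {}}) ` (A ` K) - {L. L \<subseteq> J \<and> finite L}"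
      if "x \<in> K" "A x \<subseteq> level -` J" for x
    proof -
      have "level ` A x = {n \<in> J. A x \<inter> level -` {n} \<noteq> {}}"
        using that(2) by auto
      \<comment> \<open>An infinite set with at most one point per block has an infinite trace,
        which is therefore not discarded.\<close>
      moreover have "infinite (level ` A x)"
        using inf sel finite_imageD by blast
      ultimately show ?thesis
        using that(1) by auto
    qed
    have "A x1 \<subseteq> level -` J" "A x2 \<subseteq> level -` J"
      using x(3,4) J12(3,4) by auto
    then have "infinite (\<Inter>{level ` A x1, level ` A x2})"
      using mem[of x1] mem[of x2] x(1,2) by (intro J(2)[unfolded centered_def, rule_format]) simp
    moreover have "\<Inter>{level ` A x1, level ` A x2} \<subseteq> J1 \<inter> J2"
      using x by auto
    ultimately show False
      using J12(5) by simp
  qed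
  \<comment> \<open>The empty real has empty row 0, so the ordinals of this stationary class all
    have task \<open>None\<close>.\<close>
  moreover have "fin_intersecting (A ` {x. t x = {}})"
    unfolding fin_intersecting_def
  proof (intro allI impI)
    fix C' assume C': "fin_sequence C'"
    obtain x where "rows (t x) = C'"
      using t_in_club[OF club_set_UNIV] by blast
    then have Cx: "C x = C'"
      using C' by (simp add: C_def)
    have "finite (I x - L)"
      if L: "L \<in> (\<lambda>a. {n \<in> I x. a \<inter> C' n \<noteq> {}}) ` (A ` {x. t x = {}}) - {L. L \<subseteq> I x \<and> finite L}" for L
    proof -
      obtain y where y: "t y = {}" "L = {n \<in> I x. A y \<inter> C' n \<noteq> {}}" "infinite L"
        using L by blast
      have "task y = None"
        using y(1) by (simp add: task_def rows_def)
      \<comment> \<open>For \<open>x < y\<close>, avoidance would make the trace \<open>L\<close>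
        finite. Hence infinite traces come only from \<open>y \<le> x\<close>, where
        \<open>I x\<close> decides them, and so they contain almost all of
        \<open>I x\<close>.\<close>
      have "\<not> x < y"
        using avoid[OF \<open>task y = None\<close>, of x] finite_indices_meeting[OF C'] y(2,3)
        unfolding Cx by blast
      then have "decides (I x) (trace C' (A y))"
        using dec[of y x] Cx by simp
      moreover have "I x \<inter> trace C' (A y) = L"
        unfolding y(2) trace_def by blast
      moreover have "I x - trace C' (A y) = I x - L"
        unfolding y(2) trace_def by blast
      ultimately show ?thesis
        using y(3) unfolding decides_def by simp
    qed
    then show "\<exists>I. infinite I \<and>
        centered ((\<lambda>a. {n \<in> I. a \<inter> C' n \<noteq> {}}) ` (A ` {x. t x = {}}) - {J. J \<subseteq> I \<and> finite J})"
      by (intro exI[of _ "I x"] conjI infI centered_almost_full[OF infI])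
  qed
  ultimately show ?thesis
    using inj t[of "{}"] by (intro exI[of _ A] exI[of _ "{x. t x = {}}"] conjI allI impI)
qed

text \<open>The family is carried to \<open>Field omega1\<close> along the bijection with the type;
  clubs are pulled back and the stationary set is pushed forward.\<close>

theorem theorem10:
  assumes "CH"
  shows "\<exists>a :: nat set \<Rightarrow> nat set.
    inj_on a (Field omega1) \<and>
    tight_MAD (a ` Field omega1) \<and>
    (\<forall>K. club K \<longrightarrow> \<not> fin_intersecting (a ` K)) \<and>
    (\<exists>S. stationary S \<and> fin_intersecting (a ` S))"
proof -
  obtain A :: "countable_ordinal \<Rightarrow> nat set" and S where A: "inj A" "tight_MAD (range A)"
      "\<And>K. club_set K \<Longrightarrow> \<not> fin_intersecting (A ` K)" "stationary_set S" "fin_intersecting (A ` S)"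
    using family_on_countable_ordinals[OF assms] by blast
  define a where "a = (\<lambda>x. A (Abs_countable_ordinal x))"
  have a_Rep: "a ` (Rep_countable_ordinal ` X) = A ` X" for X
    by (simp add: a_def image_image Rep_countable_ordinal_inverse)
  have "inj_on a (Field omega1)"
    by (rule inj_onI) (simp add: a_def inj_eq[OF A(1)] Abs_countable_ordinal_inject)
  moreover have "a ` Field omega1 = range A"
    using a_Rep[of UNIV] by (simp add: range_Rep_countable_ordinal)
  moreover have "\<not> fin_intersecting (a ` K)" if "club K" for K
  proof -
    have "K \<subseteq> range Rep_countable_ordinal"
      using that unfolding club_def range_Rep_countable_ordinal by blast
    then have "K = Rep_countable_ordinal ` (Rep_countable_ordinal -` K)"
      by auto
    then show ?thesis
      using A(3)[OF club_imp_club_set[OF that]] a_Rep by metis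
  qed
  moreover have "fin_intersecting (a ` (Rep_countable_ordinal ` S))"
    using A(5) by (simp add: a_Rep)
  ultimately show ?thesis
    using A(2) stationary_Rep_image[OF A(4)] by metis
qed

end
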